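(* Let $\mathbf Q \in \mathbb C^{m \times n}$ with $n< m$ be subunitary. Let $\mathbf z \in \mathbb C^m$, $\mathbf u = \mathbf Q\mathbf Q^*\mathbf z$, $\mathbf v = (\mathbf I-\mathbf Q\mathbf Q^* )\mathbf z$, and $\nu = \|\mathbf z\|$. Assume $\|\mathbf v\| \neq 0$ and $\|\mathbf u\| \neq 0$. Then $$\lambda_1 = \tfrac{1}{2}\left(1+ \nu^2 + \sqrt{1+\nu^4+2\nu^2-4\|\mathbf v\|^2}\right) \geq 1$$ is the largest eigenvalue of $\mathbf Q\mathbf Q^* + \mathbf z\mathbf z^*$, and $$0 < \lambda_{n+1} = \tfrac{1}{2}\left(1+ \nu^2 - \sqrt{1+\nu^4+2\nu^2-4\|\mathbf v\|^2}\right) \leq 1$$ is the smallest nonzero eigenvalue of $\mathbf Q\mathbf Q^* + \mathbf z\mathbf z^*$. Thus, the matrix $\begin{bmatrix}\mathbf Q & \mathbf z\end{bmatrix}\in\mathbb C^{m\times(n+1)}$ has condition number $$\kappa_2\left(\begin{bmatrix}\mathbf Q & \mathbf z\end{bmatrix}\right) = \sqrt{\frac{1+ \nu^2 + \sqrt{1+\nu^4+2\nu^2-4\|\mathbf v\|^2}}{1+ \nu^2 - \sqrt{1+\nu^4+2\nu^2-4\|\mathbf v\|^2}}}.$$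
   Context: A matrix $\mathbf Q\in\mathbb C^{m\times n}$ is called subunitary if its columns are orthonormal, i.e. $\mathbf Q^*\mathbf Q=\mathbf I_n$, where $^*$ denotes conjugate transpose. Here $n\ge 1$, $\|\cdot\|$ is the Euclidean norm, and $\begin{bmatrix}\mathbf Q & \mathbf z\end{bmatrix}$ is $\mathbf Q$ with the extra column $\mathbf z$ appended. For a matrix with full column rank, $\kappa_2$ is the 2-norm condition number: the ratio of its largest to its smallest singular value (for an $m\times(n+1)$ matrix $\mathbf B$ with $m \ge n+1$, the singular values are the square roots of the $n+1$ eigenvalues of $\mathbf B^*\mathbf B$). *)

theory Defs
  imports
    "HOL.Complex"
    "Jordan_Normal_Form.Schur_Decomposition"
    "Jordan_Normal_Form.Spectral_Radius"
begin

definition subunitary :: "complex mat \<Rightarrow> bool" where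
  "subunitary Q \<longleftrightarrow> mat_adjoint Q * Q = 1\<^sub>m (dim_col Q)"

definition euclid_norm :: "complex vec \<Rightarrow> real" where
  "euclid_norm x = sqrt (\<Sum>i<dim_vec x. (cmod (x $ i))\<^sup>2)"

definition append_col :: "complex mat \<Rightarrow> complex vec \<Rightarrow> complex mat" where
  "append_col A x = mat_of_cols (dim_row A) (cols A @ [x])"

definition rank_one :: "complex vec \<Rightarrow> complex mat" where
  "rank_one x = mat_of_cols (dim_vec x) [x] * mat_adjoint (mat_of_cols (dim_vec x) [x])"

text \<open>The eigenvalues are complex numbers, so the next two notions include that all of them
  are real.\<close>

definition largest_eigenvalue :: "complex mat \<Rightarrow> real \<Rightarrow> bool" where
  "largest_eigenvalue A r \<longleftrightarrow>
     eigenvalue A (complex_of_real r) \<and>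
     (\<forall>\<mu>. eigenvalue A \<mu> \<longrightarrow> \<mu> \<in> \<real> \<and> Re \<mu> \<le> r)"

definition smallest_nonzero_eigenvalue :: "complex mat \<Rightarrow> real \<Rightarrow> bool" where
  "smallest_nonzero_eigenvalue A r \<longleftrightarrow>
     r \<noteq> 0 \<and> eigenvalue A (complex_of_real r) \<and>
     (\<forall>\<mu>. eigenvalue A \<mu> \<and> \<mu> \<noteq> 0 \<longrightarrow> \<mu> \<in> \<real> \<and> r \<le> Re \<mu>)"

text \<open>The singular values of a matrix with at least as many rows as columns, without their
  multiplicities: the nonnegative square roots of the eigenvalues of \<open>B\<^sup>* B\<close>.\<close>

definition singular_values :: "complex mat \<Rightarrow> real set" where
  "singular_values B =
     {\<sigma>. 0 \<le> \<sigma> \<and> eigenvalue (mat_adjoint B * B) (complex_of_real (\<sigma>\<^sup>2))}"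

text \<open>Only meant for matrices of full column rank; if the smallest singular value is 0, the
  quotient takes the junk value 0.\<close>

definition cond2 :: "complex mat \<Rightarrow> real" where
  "cond2 B = Max (singular_values B) / Min (singular_values B)"

end

theory Submission
  imports Defs
begin

text \<open>
  Write \<open>B\<close> for the matrix \<open>Q\<close> with the column \<open>z\<close> appended. Then \<open>Q Q\<^sup>* + z z\<^sup>* = B B\<^sup>*\<close>
  (\<open>append_col_times_adjoint\<close>), and the products \<open>B B\<^sup>*\<close> and \<open>B\<^sup>* B\<close> have the same nonzero
  eigenvalues (\<open>eigenvalue_mult_commute\<close>). So all the claims concern the spectrum of the small
  Gram matrix \<open>B\<^sup>* B\<close>. As the columns of \<open>Q\<close> are orthonormal, this is the identity of size \<open>n\<close>
  bordered by the column \<open>w = Q\<^sup>* z\<close>, the row \<open>w\<^sup>*\<close> and the corner entry \<open>\<nu>\<^sup>2\<close>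
  (\<open>adjoint_times_append_col\<close>).

  A bordered identity has a transparent spectrum: eliminating the first \<open>n\<close> coordinates from the
  eigenvector equation shows that \<open>\<mu> \<noteq> 1\<close> is an eigenvalue iff \<open>(\<mu> - 1) (\<mu> - \<nu>\<^sup>2) = \<parallel>w\<parallel>\<^sup>2\<close>
  (\<open>eigenvalue_bordered_identity\<close>). By Pythagoras \<open>\<parallel>w\<parallel>\<^sup>2 = \<nu>\<^sup>2 - \<parallel>v\<parallel>\<^sup>2\<close>, so this is the
  quadratic equation \<open>\<mu>\<^sup>2 - (1 + \<nu>\<^sup>2) \<mu> + \<parallel>v\<parallel>\<^sup>2 = 0\<close>, whose roots are the two numbers in the
  theorem. At \<open>\<mu> = 1\<close> the quadratic takes the value \<open>- \<parallel>w\<parallel>\<^sup>2 = - \<parallel>u\<parallel>\<^sup>2 < 0\<close>, hence \<open>1\<close> lies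
  strictly between the roots; thus \<open>1\<close>, the only other possible nonzero eigenvalue, is
  never extreme. The product of the roots is \<open>\<parallel>v\<parallel>\<^sup>2 > 0\<close>, so the smaller root is positive.

  The singular values of \<open>B\<close> are the square roots of the eigenvalues of the same Gram matrix, so
  the condition number is the square root of the ratio of the two roots (\<open>cond2_eq_sqrt_ratio\<close>).
\<close>

section \<open>Eigenvalues of products and of bordered identity matrices\<close>

text \<open>If \<open>x\<close> is an eigenvector of \<open>A B\<close>, then \<open>B x\<close> is one of \<open>B A\<close>; it is nonzero because
  \<open>A (B x) = \<mu> x\<close> is.\<close>

lemma eigenvalue_mult_swap:
  fixes A B :: "'a :: field mat"
  assumes A: "A \<in> carrier_mat m k" and B: "B \<in> carrier_mat k m"
    and ev: "eigenvalue (A * B) \<mu>" and nz: "\<mu> \<noteq> 0"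
  shows "eigenvalue (B * A) \<mu>"
proof -
  obtain x where x: "x \<in> carrier_vec m" "x \<noteq> 0\<^sub>v m" "(A * B) *\<^sub>v x = \<mu> \<cdot>\<^sub>v x"
    using ev A unfolding eigenvalue_def eigenvector_def by auto
  have Bx: "B *\<^sub>v x \<in> carrier_vec k" using B x by auto
  have ABx: "A *\<^sub>v (B *\<^sub>v x) = \<mu> \<cdot>\<^sub>v x"
    using assoc_mult_mat_vec[OF A B x(1)] x(3) by simp
  have "(B * A) *\<^sub>v (B *\<^sub>v x) = \<mu> \<cdot>\<^sub>v (B *\<^sub>v x)"
    using assoc_mult_mat_vec[OF B A Bx] ABx mult_mat_vec[OF B x(1)] by simp
  moreover have "B *\<^sub>v x \<noteq> 0\<^sub>v k"
  proof
    assume "B *\<^sub>v x = 0\<^sub>v k"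
    moreover have "A *\<^sub>v 0\<^sub>v k = 0\<^sub>v m" using A by (intro eq_vecI) auto
    ultimately have 0: "\<mu> \<cdot>\<^sub>v x = 0\<^sub>v m" using ABx by simp
    have "x $ i = 0" if "i < m" for i
      using arg_cong[OF 0, of "\<lambda>y. y $ i"] that x(1) nz by simp
    then have "x = 0\<^sub>v m" using x(1) by (intro eq_vecI) auto
    with x(2) show False by simp
  qed
  ultimately show ?thesis
    using Bx B unfolding eigenvalue_def eigenvector_def by auto
qed

lemma eigenvalue_mult_commute:
  fixes A B :: "'a :: field mat"
  assumes A: "A \<in> carrier_mat m k" and B: "B \<in> carrier_mat k m" and nz: "\<mu> \<noteq> 0"
  shows "eigenvalue (A * B) \<mu> \<longleftrightarrow> eigenvalue (B * A) \<mu>"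
  using eigenvalue_mult_swap[OF A B _ nz] eigenvalue_mult_swap[OF B A _ nz] by (rule iffI)

definition bordered_identity :: "nat \<Rightarrow> 'a vec \<Rightarrow> 'a vec \<Rightarrow> 'a \<Rightarrow> 'a :: zero_neq_one mat" where
  "bordered_identity n w r c = mat (Suc n) (Suc n) (\<lambda>(i, j).
     if i < n then if j < n then if i = j then 1 else 0 else w $ i
     else if j < n then r $ j else c)"

lemma bordered_identity_carrier [simp]:
  "bordered_identity n w r c \<in> carrier_mat (Suc n) (Suc n)"
  by (simp add: bordered_identity_def)

lemma bordered_identity_mult_index:
  fixes y :: "'a :: field vec"
  assumes "y \<in> carrier_vec (Suc n)"
  shows "k < n \<Longrightarrow> (bordered_identity n w r c *\<^sub>v y) $ k = y $ k + w $ k * y $ n"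
    and "(bordered_identity n w r c *\<^sub>v y) $ n = (\<Sum>j<n. r $ j * y $ j) + c * y $ n"
proof -
  have "(\<Sum>j<n. (if k = j then 1 else 0) * y $ j) = (\<Sum>j<n. if j = k then y $ j else 0)"
    by (rule sum.cong) auto
  then show "(bordered_identity n w r c *\<^sub>v y) $ k = y $ k + w $ k * y $ n" if "k < n"
    using that assms
    by (simp add: bordered_identity_def scalar_prod_def atLeast0LessThan)
  show "(bordered_identity n w r c *\<^sub>v y) $ n = (\<Sum>j<n. r $ j * y $ j) + c * y $ n"
    using assms by (simp add: bordered_identity_def scalar_prod_def atLeast0LessThan)
qed

text \<open>For \<open>\<mu> \<noteq> 1\<close> the first \<open>n\<close> rows of the eigenvector equation determine the first \<open>n\<close>
  coordinates as \<open>y\<^sub>k = w\<^sub>k y\<^sub>n / (\<mu> - 1)\<close>, so \<open>y\<^sub>n\<close> can be normalised to \<open>1\<close>; what remains of the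
  last row is the equation on the right (the Schur complement vanishes).\<close>

lemma eigenvalue_bordered_identity:
  fixes w r :: "'a :: field vec"
  assumes \<mu>: "\<mu> \<noteq> 1"
  shows "eigenvalue (bordered_identity n w r c) \<mu> \<longleftrightarrow>
    (\<mu> - 1) * (\<mu> - c) = (\<Sum>j<n. r $ j * w $ j)" (is "eigenvalue ?G \<mu> \<longleftrightarrow> ?q")
proof
  assume "eigenvalue ?G \<mu>"
  then obtain y where y: "y \<in> carrier_vec (Suc n)" "y \<noteq> 0\<^sub>v (Suc n)" "?G *\<^sub>v y = \<mu> \<cdot>\<^sub>v y"
    unfolding eigenvalue_def eigenvector_def using bordered_identity_carrier
    by (metis carrier_matD(1))
  have top: "(\<mu> - 1) * y $ k = w $ k * y $ n" if "k < n" for k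
  proof -
    have "y $ k + w $ k * y $ n = \<mu> * y $ k"
      using bordered_identity_mult_index(1)[OF y(1) that, of w r c] y that by simp
    then show ?thesis by (simp add: algebra_simps)
  qed
  have bottom: "(\<mu> - c) * y $ n = (\<Sum>j<n. r $ j * y $ j)"
  proof -
    have "(\<Sum>j<n. r $ j * y $ j) + c * y $ n = \<mu> * y $ n"
      using bordered_identity_mult_index(2)[OF y(1), of w r c] y by simp
    then show ?thesis by (simp add: algebra_simps)
  qed
  have yn: "y $ n \<noteq> 0"
  proof
    assume 0: "y $ n = 0"
    then have "y $ k = 0" if "k < Suc n" for k
      using top[of k] \<mu> that by (cases "k = n") auto
    then have "y = 0\<^sub>v (Suc n)" using y(1) by (intro eq_vecI) auto
    with y(2) show False by simp
  qed
  have "(\<mu> - 1) * (\<mu> - c) * y $ n = (\<Sum>j<n. r $ j * ((\<mu> - 1) * y $ j))"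
    by (simp add: mult.assoc bottom sum_distrib_left mult.left_commute)
  also have "\<dots> = (\<Sum>j<n. r $ j * w $ j) * y $ n"
    by (simp add: top sum_distrib_right mult.assoc)
  finally show ?q using yn by simp
next
  assume q: ?q
  define y where "y = vec (Suc n) (\<lambda>k. if k < n then w $ k / (\<mu> - 1) else 1)"
  have y: "y \<in> carrier_vec (Suc n)" by (simp add: y_def)
  have "(?G *\<^sub>v y) $ k = (\<mu> \<cdot>\<^sub>v y) $ k" if k: "k < Suc n" for k
  proof (cases "k < n")
    case True
    then show ?thesis
      using bordered_identity_mult_index(1)[OF y True, of w r c] \<mu>
      by (simp add: y_def field_simps)
  next
    case False
    then have k: "k = n" using k by simp
    have "(\<Sum>j<n. r $ j * y $ j) = (\<Sum>j<n. r $ j * w $ j) / (\<mu> - 1)"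
      by (simp add: y_def sum_divide_distrib)
    also have "\<dots> = \<mu> - c" using \<mu> by (simp flip: q)
    finally show ?thesis
      using bordered_identity_mult_index(2)[OF y, of w r c] by (simp add: y_def k)
  qed
  then have "?G *\<^sub>v y = \<mu> \<cdot>\<^sub>v y"
    using y by (intro eq_vecI) (auto simp: bordered_identity_def)
  moreover have "y \<noteq> 0\<^sub>v (Suc n)"
  proof
    assume "y = 0\<^sub>v (Suc n)"
    then have "y $ n = 0" by simp
    then show False by (simp add: y_def)
  qed
  ultimately show "eigenvalue ?G \<mu>"
    using y bordered_identity_carrier unfolding eigenvalue_def eigenvector_def
    by (metis carrier_matD(1))
qed

section \<open>Adjoints and norms\<close>

lemma mat_adjoint_index [simp]:
  "dim_row (mat_adjoint A) = dim_col A" "dim_col (mat_adjoint A) = dim_row A"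
  "i < dim_col A \<Longrightarrow> j < dim_row A \<Longrightarrow> mat_adjoint A $$ (i, j) = conjugate (A $$ (j, i))"
  by (auto simp: mat_adjoint_def mat_of_rows_index)

lemma mat_adjoint_carrier [simp]: "A \<in> carrier_mat m n \<Longrightarrow> mat_adjoint A \<in> carrier_mat n m"
  by (intro carrier_matI) auto

lemma mult_mat_vec_cscalar_prod:
  fixes A :: "complex mat"
  assumes "A \<in> carrier_mat m n" "x \<in> carrier_vec n" "y \<in> carrier_vec m"
  shows "(A *\<^sub>v x) \<bullet>c y = x \<bullet>c (mat_adjoint A *\<^sub>v y)"
proof -
  have "(A *\<^sub>v x) \<bullet>c y = (\<Sum>i<m. \<Sum>j<n. A $$ (i, j) * x $ j * cnj (y $ i))"
    using assms by (simp add: scalar_prod_def atLeast0LessThan sum_distrib_right)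
  also have "\<dots> = (\<Sum>j<n. \<Sum>i<m. A $$ (i, j) * x $ j * cnj (y $ i))"
    by (rule sum.swap)
  also have "\<dots> = x \<bullet>c (mat_adjoint A *\<^sub>v y)"
    using assms by (simp add: scalar_prod_def atLeast0LessThan sum_distrib_left ac_simps)
  finally show ?thesis .
qed

lemma euclid_norm_square: "(euclid_norm x)\<^sup>2 = (\<Sum>i<dim_vec x. (cmod (x $ i))\<^sup>2)"
  by (simp add: euclid_norm_def sum_nonneg)

lemma cscalar_prod_self: "x \<bullet>c x = complex_of_real ((euclid_norm x)\<^sup>2)"
  unfolding scalar_prod_def euclid_norm_square of_real_sum
  by (simp add: atLeast0LessThan complex_norm_square del: of_real_power)

section \<open>The projection onto the range of a subunitary matrix\<close>

lemma subunitary_norm_mult: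
  assumes Q: "Q \<in> carrier_mat m n" and sub: "subunitary Q" and w: "w \<in> carrier_vec n"
  shows "(euclid_norm (Q *\<^sub>v w))\<^sup>2 = (euclid_norm w)\<^sup>2"
proof -
  have "mat_adjoint Q *\<^sub>v (Q *\<^sub>v w) = w"
    using assoc_mult_mat_vec[of "mat_adjoint Q" n m Q n w] assms by (simp add: subunitary_def)
  then have "(Q *\<^sub>v w) \<bullet>c (Q *\<^sub>v w) = w \<bullet>c w"
    using mult_mat_vec_cscalar_prod[OF Q w, of "Q *\<^sub>v w"] Q w by simp
  then show ?thesis by (simp only: cscalar_prod_self of_real_eq_iff)
qed

text \<open>Pythagoras: the residual \<open>v\<close> is orthogonal to the range of \<open>Q\<close>, since \<open>Q\<^sup>* v = 0\<close>. So
  \<open>\<langle>v, v\<rangle> = \<langle>z, v\<rangle> = \<langle>z, z\<rangle> - \<langle>Q\<^sup>* z, Q\<^sup>* z\<rangle>\<close>.\<close>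

lemma subunitary_pythagoras:
  assumes Q: "Q \<in> carrier_mat m n" and sub: "subunitary Q" and z: "z \<in> carrier_vec m"
  shows "(euclid_norm ((1\<^sub>m m - Q * mat_adjoint Q) *\<^sub>v z))\<^sup>2 =
    (euclid_norm z)\<^sup>2 - (euclid_norm (mat_adjoint Q *\<^sub>v z))\<^sup>2"
proof -
  define w where "w = mat_adjoint Q *\<^sub>v z"
  define v where "v = z - Q *\<^sub>v w"
  have Qa: "mat_adjoint Q \<in> carrier_mat n m" using Q by simp
  have w: "w \<in> carrier_vec n" unfolding w_def using Qa z by (rule mult_mat_vec_carrier)
  have Qw: "Q *\<^sub>v w \<in> carrier_vec m" using Q w by (rule mult_mat_vec_carrier)
  have v: "v \<in> carrier_vec m" using z Qw by (simp add: v_def)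
  have v_eq: "(1\<^sub>m m - Q * mat_adjoint Q) *\<^sub>v z = v"
    using minus_mult_distrib_mat_vec[of "1\<^sub>m m" m m "Q * mat_adjoint Q" z]
      assoc_mult_mat_vec[OF Q Qa z] Q Qa z by (simp add: v_def w_def)
  have "mat_adjoint Q *\<^sub>v v = 0\<^sub>v n"
  proof -
    have "mat_adjoint Q *\<^sub>v (Q *\<^sub>v w) = w"
      using assoc_mult_mat_vec[OF Qa Q w] sub w Q by (simp add: subunitary_def)
    then show ?thesis
      unfolding v_def using mult_minus_distrib_mat_vec[OF Qa z Qw] w
      by (simp flip: w_def)
  qed
  then have orth: "(Q *\<^sub>v w) \<bullet>c v = 0"
    using mult_mat_vec_cscalar_prod[OF Q w v] w by simp
  have "v \<bullet>c v = z \<bullet>c v"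
    using minus_scalar_prod_distrib[OF z Qw, of "conjugate v"] v orth
    by (simp flip: v_def)
  also have "\<dots> = cnj (v \<bullet>c z)"
    using conjugate_conjugate_sprod[OF v z] conjugate_vec_sprod_comm[OF z v]
    by (metis complex_cnj_cnj conjugate_complex_def)
  also have "v \<bullet>c z = z \<bullet>c z - (Q *\<^sub>v w) \<bullet>c z"
    unfolding v_def using minus_scalar_prod_distrib[OF z Qw, of "conjugate z"] z by simp
  also have "(Q *\<^sub>v w) \<bullet>c z = w \<bullet>c w"
    using mult_mat_vec_cscalar_prod[OF Q w z] by (simp flip: w_def)
  finally have "complex_of_real ((euclid_norm v)\<^sup>2) =
      complex_of_real ((euclid_norm z)\<^sup>2 - (euclid_norm w)\<^sup>2)"
    by (simp add: cscalar_prod_self)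
  then show ?thesis by (simp only: of_real_eq_iff v_eq flip: w_def)
qed

section \<open>Appending a column\<close>

lemma append_col_carrier [simp]:
  "A \<in> carrier_mat m n \<Longrightarrow> append_col A x \<in> carrier_mat m (Suc n)"
  by (intro carrier_matI) (auto simp: append_col_def)

lemma append_col_index:
  assumes "A \<in> carrier_mat m n" "i < m" "j < Suc n"
  shows "append_col A x $$ (i, j) = (if j < n then A $$ (i, j) else x $ i)"
  using assms by (auto simp: append_col_def mat_of_cols_index nth_append)

lemma append_col_times_adjoint:
  assumes "Q \<in> carrier_mat m n" "z \<in> carrier_vec m"
  shows "append_col Q z * mat_adjoint (append_col Q z) = Q * mat_adjoint Q + rank_one z"
  using assms carrier_matD[OF append_col_carrier[OF assms(1), of z]]
  by (intro eq_matI)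
    (auto simp: rank_one_def scalar_prod_def append_col_index mat_of_cols_index)

lemma adjoint_times_append_col:
  assumes Q: "Q \<in> carrier_mat m n" and sub: "subunitary Q" and z: "z \<in> carrier_vec m"
  shows "mat_adjoint (append_col Q z) * append_col Q z =
    bordered_identity n (mat_adjoint Q *\<^sub>v z) (conjugate (mat_adjoint Q *\<^sub>v z)) (z \<bullet>c z)"
    (is "?L = ?R")
proof (rule eq_matI)
  have B: "append_col Q z \<in> carrier_mat m (Suc n)" using Q by simp
  have orth: "(\<Sum>k<m. Q $$ (k, j) * cnj (Q $$ (k, i))) = (if i = j then 1 else 0)"
    if "i < n" "j < n" for i j
  proof -
    have "(mat_adjoint Q * Q) $$ (i, j) = (if i = j then 1 else 0)"
      using sub Q that by (simp add: subunitary_def)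
    then show ?thesis
      using Q that by (simp add: scalar_prod_def atLeast0LessThan mult.commute)
  qed
  fix i j assume "i < dim_row ?R" "j < dim_col ?R"
  then have ij: "i < Suc n" "j < Suc n" by (simp_all add: bordered_identity_def)
  have "?L $$ (i, j) = (\<Sum>k<m. append_col Q z $$ (k, j) * cnj (append_col Q z $$ (k, i)))"
    using carrier_matD[OF B] ij by (simp add: scalar_prod_def atLeast0LessThan mult.commute)
  also have "\<dots> = ?R $$ (i, j)"
    using ij Q z
    by (auto simp: bordered_identity_def append_col_index orth scalar_prod_def atLeast0LessThan
        mult.commute intro!: sum.cong)
  finally show "?L $$ (i, j) = ?R $$ (i, j)" .
qed (use Q carrier_matD[OF append_col_carrier[OF Q, of z]] in \<open>auto simp: bordered_identity_def\<close>)

section \<open>The extreme eigenvalues and the condition number\<close>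

text \<open>The discriminant equals \<open>(a + b - 1)\<^sup>2 + 4 b\<close>, so its root exceeds \<open>\<bar>a + b - 1\<bar>\<close>; this
  separates the roots from \<open>1\<close>.\<close>

lemma quadratic_roots_separated:
  fixes a b s :: real
  assumes a: "0 < a" and b: "0 < b" and s: "s = sqrt ((1 + (a + b))\<^sup>2 - 4 * a)"
  shows "1 < (1 + (a + b) + s) / 2" "0 < (1 + (a + b) - s) / 2" "(1 + (a + b) - s) / 2 < 1"
    and "s\<^sup>2 = (1 + (a + b))\<^sup>2 - 4 * a"
proof -
  have D: "(1 + (a + b))\<^sup>2 - 4 * a = (a + b - 1)\<^sup>2 + 4 * b"
    by (simp add: power2_eq_square algebra_simps)
  have "sqrt ((a + b - 1)\<^sup>2) < s"
    unfolding s D using b by (intro real_sqrt_less_mono) simp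
  then have "\<bar>a + b - 1\<bar> < s" by simp
  then show "1 < (1 + (a + b) + s) / 2" "(1 + (a + b) - s) / 2 < 1" by auto
  have "s < sqrt ((1 + (a + b))\<^sup>2)"
    unfolding s using a by (intro real_sqrt_less_mono) simp
  then show "0 < (1 + (a + b) - s) / 2" using a b by simp
  show "s\<^sup>2 = (1 + (a + b))\<^sup>2 - 4 * a"
    unfolding s D using b by simp
qed

text \<open>The alternative \<open>\<mu> = 1\<close> is there because the Gram matrix of \<open>Q\<close> with \<open>z\<close> appended has this
  further eigenvalue exactly when \<open>n > 1\<close> (if \<open>Q\<^sup>* z \<noteq> 0\<close>). Lying between \<open>q\<close> and \<open>p\<close>, it affects
  neither extreme singular value.\<close>

lemma cond2_eq_sqrt_ratio:
  assumes ev: "eigenvalue (mat_adjoint B * B) (complex_of_real p)"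
      "eigenvalue (mat_adjoint B * B) (complex_of_real q)"
    and only: "\<And>\<mu>. eigenvalue (mat_adjoint B * B) \<mu> \<Longrightarrow>
      \<mu> = 1 \<or> \<mu> = complex_of_real p \<or> \<mu> = complex_of_real q"
    and p: "1 \<le> p" and q: "0 \<le> q" "q \<le> 1"
  shows "cond2 B = sqrt (p / q)"
proof -
  have sub: "singular_values B \<subseteq> {1, sqrt p, sqrt q}"
  proof
    fix \<sigma> assume "\<sigma> \<in> singular_values B"
    then have \<sigma>: "0 \<le> \<sigma>" and "eigenvalue (mat_adjoint B * B) (complex_of_real (\<sigma>\<^sup>2))"
      by (auto simp: singular_values_def)
    from only[OF this(2)] have "\<sigma>\<^sup>2 = 1 \<or> \<sigma>\<^sup>2 = p \<or> \<sigma>\<^sup>2 = q"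
      by (metis of_real_1 of_real_eq_iff)
    then show "\<sigma> \<in> {1, sqrt p, sqrt q}"
      using \<sigma> by (metis insertI1 insert_commute real_sqrt_one real_sqrt_unique)
  qed
  then have fin: "finite (singular_values B)" by (rule finite_subset) simp
  have mem: "sqrt p \<in> singular_values B" "sqrt q \<in> singular_values B"
    using ev p q by (auto simp: singular_values_def simp del: of_real_power)
  have "Max (singular_values B) = sqrt p"
    using sub p q by (intro Max_eqI fin mem) auto
  moreover have "Min (singular_values B) = sqrt q"
    using sub p q by (intro Min_eqI fin mem) auto
  ultimately show ?thesis by (simp add: cond2_def real_sqrt_divide)
qed

theorem theorem3p3:
  fixes m n :: nat and Q :: "complex mat" and z u v :: "complex vec"
    and \<nu> lam_first lam_last :: real
  assumes "1 \<le> n" and "n < m"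
    and "Q \<in> carrier_mat m n" and "subunitary Q"
    and "z \<in> carrier_vec m"
    and "u = (Q * mat_adjoint Q) *\<^sub>v z"
    and "v = (1\<^sub>m m - Q * mat_adjoint Q) *\<^sub>v z"
    and "\<nu> = euclid_norm z"
    and "euclid_norm v \<noteq> 0" and "euclid_norm u \<noteq> 0"
    and "lam_first = 1/2 * (1 + \<nu>^2 + sqrt (1 + \<nu>^4 + 2 * \<nu>^2 - 4 * (euclid_norm v)^2))"
    and "lam_last = 1/2 * (1 + \<nu>^2 - sqrt (1 + \<nu>^4 + 2 * \<nu>^2 - 4 * (euclid_norm v)^2))"
  shows "lam_first \<ge> 1 \<and> largest_eigenvalue (Q * mat_adjoint Q + rank_one z) lam_first
    \<and> 0 < lam_last \<and> lam_last \<le> 1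
    \<and> smallest_nonzero_eigenvalue (Q * mat_adjoint Q + rank_one z) lam_last
    \<and> cond2 (append_col Q z) =
        sqrt ((1 + \<nu>^2 + sqrt (1 + \<nu>^4 + 2 * \<nu>^2 - 4 * (euclid_norm v)^2))
            / (1 + \<nu>^2 - sqrt (1 + \<nu>^4 + 2 * \<nu>^2 - 4 * (euclid_norm v)^2)))"
proof -
  note Q = assms(3) and sub = assms(4) and z = assms(5)
  define w where "w = mat_adjoint Q *\<^sub>v z"
  define a where "a = (euclid_norm v)\<^sup>2"
  define b where "b = (euclid_norm w)\<^sup>2"
  define s where "s = sqrt (1 + \<nu>^4 + 2 * \<nu>^2 - 4 * (euclid_norm v)^2)"
  have w: "w \<in> carrier_vec n" using Q z by (simp add: w_def mult_mat_vec_carrier[of _ n m])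
  have "u = Q *\<^sub>v w"
    using assoc_mult_mat_vec[of Q m n "mat_adjoint Q" m z] Q z by (simp add: assms(6) w_def)
  then have "b = (euclid_norm u)\<^sup>2"
    using subunitary_norm_mult[OF Q sub w] by (simp add: b_def)
  then have b: "0 < b" using assms(10) by simp
  have a: "0 < a" using assms(9) by (simp add: a_def)
  have ab: "\<nu>\<^sup>2 = a + b"
    using subunitary_pythagoras[OF Q sub z] by (simp add: a_def b_def w_def assms(7,8))
  have "\<nu> ^ 4 = (\<nu>\<^sup>2)\<^sup>2" by simp
  then have s: "s = sqrt ((1 + (a + b))\<^sup>2 - 4 * a)"
    unfolding s_def by (simp add: ab power2_sum flip: a_def)
  have lam: "lam_first = (1 + (a + b) + s) / 2" "lam_last = (1 + (a + b) - s) / 2"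
    by (simp_all add: assms(11,12) ab s_def)
  note roots = quadratic_roots_separated[OF a b s, folded lam]

  let ?B = "append_col Q z"
  have B: "?B \<in> carrier_mat m (Suc n)" using Q by simp
  have "(\<mu> - 1) * (\<mu> - complex_of_real (a + b)) - complex_of_real b =
      (\<mu> - complex_of_real lam_first) * (\<mu> - complex_of_real lam_last)" for \<mu>
  proof -
    have sum: "lam_first + lam_last = 1 + a + b" by (simp add: lam field_simps)
    have "lam_first * lam_last = ((1 + (a + b))\<^sup>2 - s\<^sup>2) / 4"
      by (simp add: lam power2_eq_square field_simps)
    then have prod: "lam_first * lam_last = a" by (simp add: roots(4))
    have "(\<mu> - complex_of_real lam_first) * (\<mu> - complex_of_real lam_last) =
        \<mu> * \<mu> - complex_of_real (lam_first + lam_last) * \<mu> + complex_of_real (lam_first * lam_last)"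
      by (simp add: algebra_simps)
    then show ?thesis unfolding sum prod by (simp add: algebra_simps)
  qed
  then have quadratic: "(\<mu> - 1) * (\<mu> - complex_of_real (a + b)) = complex_of_real b \<longleftrightarrow>
      \<mu> = complex_of_real lam_first \<or> \<mu> = complex_of_real lam_last" for \<mu>
    by (metis mult_eq_0_iff right_minus_eq)
  have "z \<bullet>c z = complex_of_real (a + b)"
    using cscalar_prod_self[of z] by (simp flip: ab assms(8))
  moreover have "(\<Sum>j<n. conjugate w $ j * w $ j) = complex_of_real b"
    using cscalar_prod_self[of w] w
    by (simp add: scalar_prod_def atLeast0LessThan b_def mult.commute)
  ultimately have gram: "eigenvalue (mat_adjoint ?B * ?B) \<mu> \<longleftrightarrow>
      \<mu> = complex_of_real lam_first \<or> \<mu> = complex_of_real lam_last" if "\<mu> \<noteq> 1" for \<mu>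
    using eigenvalue_bordered_identity[OF that, of n w "conjugate w"] quadratic
    unfolding adjoint_times_append_col[OF Q sub z] by (simp flip: w_def)
  have ne1: "complex_of_real lam_first \<noteq> 1" "complex_of_real lam_last \<noteq> 1"
    using roots by (metis less_irrefl of_real_1 of_real_eq_iff)+
  have ev: "eigenvalue (mat_adjoint ?B * ?B) (complex_of_real lam_first)"
    "eigenvalue (mat_adjoint ?B * ?B) (complex_of_real lam_last)"
    using gram ne1 by auto
  have swap: "eigenvalue (Q * mat_adjoint Q + rank_one z) \<mu> \<longleftrightarrow>
      eigenvalue (mat_adjoint ?B * ?B) \<mu>" if "\<mu> \<noteq> 0" for \<mu>
    using eigenvalue_mult_commute[OF B mat_adjoint_carrier[OF B] that]
    by (simp add: append_col_times_adjoint[OF Q z])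
  have only: "\<mu> = 0 \<or> \<mu> = 1 \<or> \<mu> = complex_of_real lam_first \<or> \<mu> = complex_of_real lam_last"
    if "eigenvalue (Q * mat_adjoint Q + rank_one z) \<mu>" for \<mu>
    using that swap gram by blast
  have "largest_eigenvalue (Q * mat_adjoint Q + rank_one z) lam_first"
    unfolding largest_eigenvalue_def using only swap ev(1) roots by fastforce
  moreover have "smallest_nonzero_eigenvalue (Q * mat_adjoint Q + rank_one z) lam_last"
    unfolding smallest_nonzero_eigenvalue_def using only swap ev(2) roots by fastforce
  moreover have "cond2 ?B = sqrt (lam_first / lam_last)"
    using ev gram roots by (intro cond2_eq_sqrt_ratio) auto
  moreover have "1 + \<nu>^2 + s = 2 * lam_first" "1 + \<nu>^2 - s = 2 * lam_last"
    by (simp_all add: lam ab field_simps)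
  then have "lam_first / lam_last = (1 + \<nu>^2 + s) / (1 + \<nu>^2 - s)"
    by simp
  ultimately show ?thesis
    using roots by (simp add: s_def)
qed

end
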